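(* Let $H$ be a real Hilbert space and let $J:H\to\mathbb{R}$ be twice continuously Fréchet differentiable with a global minimizer $x^*\in H$. Suppose that for some constant $L>0$ $$\|J''(x)-J''(y)\|_{L(H)}\le L\|x-y\|,\quad x,y\in H.$$ Let $\xi\in H$ and suppose that $w\in H$ satisfies $x^*-\xi=J''(x^* )w$, that $L\|w\|<1$, and that $L\widehat C_0<2$, where $$\widehat C_0=\frac{1}{1-L\|w\|}\left(L\|w\|^2+\sqrt{L^2\|w\|^4+(1-L\|w\|)\left(4\|w\|^2+\tfrac{8}{3}L\|w\|^3\right)}\right).$$ Then, for every $\alpha>0$, the functional $T_\alpha:H\to\mathbb{R}$, $T_\alpha(x)=J(x)+\alpha\|x-\xi\|^2$, has a unique global minimizer $u_\alpha$ on $H$, and $$\|u_\alpha-x^*\|\le\widehat C_0\alpha.$$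
   Context: $\|\cdot\|$ is the norm of $H$ and $\|\cdot\|_{L(H)}$ is the operator norm on bounded linear operators on $H$. $J'(x)\in H$ is the gradient and $J''(x)\in L(H)$ the (self-adjoint) second Fréchet derivative, via the Riesz identification. No weak lower semicontinuity of $J$ is assumed. *)

theory Defs
  imports "HOL-Analysis.Analysis"
begin

definition global_minimizer :: "('a \<Rightarrow> real) \<Rightarrow> 'a \<Rightarrow> bool" where
  "global_minimizer f x \<longleftrightarrow> (\<forall>y. f x \<le> f y)"

text \<open>
  The gradient of J is G and its second Frechet derivative is K. Both are taken through the
  Riesz identification: the derivative of J at x is the functional h \<mapsto> h \<bullet> G x, and K x is the
  Frechet derivative of G at x. The norm on the type of bounded linear maps is the operator norm,
  so continuity of K is continuity of the second derivative into L(H).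
\<close>

definition twice_cont_frechet_differentiable ::
  "('a::real_inner \<Rightarrow> real) \<Rightarrow> ('a \<Rightarrow> 'a) \<Rightarrow> ('a \<Rightarrow> 'a \<Rightarrow>\<^sub>L 'a) \<Rightarrow> bool" where
  "twice_cont_frechet_differentiable J G K \<longleftrightarrow>
     (\<forall>x. GDERIV J x :> G x) \<and>
     (\<forall>x. (G has_derivative blinfun_apply (K x)) (at x)) \<and>
     continuous_on UNIV K"

definition tikhonov :: "('a::real_inner \<Rightarrow> real) \<Rightarrow> 'a \<Rightarrow> real \<Rightarrow> 'a \<Rightarrow> real" where
  "tikhonov J \<xi> \<alpha> x = J x + \<alpha> * (norm (x - \<xi>))\<^sup>2"

definition C0_hat :: "real \<Rightarrow> 'a::real_normed_vector \<Rightarrow> real" where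
  "C0_hat L w = 1 / (1 - L * norm w) *
     (L * norm w ^ 2 +
      sqrt (L ^ 2 * norm w ^ 4 +
            (1 - L * norm w) * (4 * norm w ^ 2 + 8 / 3 * L * norm w ^ 3)))"

end

theory Submission
  imports Defs
begin

text \<open>
  Write A = J''(x*) and v = x* - 2 \<alpha> w; for quadratic J, v is the right competitor because the terms
  in (A w, w) then cancel exactly. If T(u) \<le> T(v) and h = u - x*, adding the inequality
  J(u + 2 \<alpha> w) \<ge> J(x*), expanded at u, to T(u) \<le> T(v), expanded at x*, yields
  (1 - L|w|) |h|^2 \<le> 2 L |w|^2 \<alpha> |h| + (4 |w|^2 + 8/3 L |w|^3) \<alpha>^2.
  The positive root of this quadratic inequality is the constant C0_hat times \<alpha>, so the whole sublevel
  set of T(v) lies in the ball of radius C0_hat \<alpha> about x*. On that ball J'' \<ge> - L C0_hat \<alpha>,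
  since A \<ge> 0, so L C0_hat < 2 makes T strongly convex there. Hence a minimizing sequence in the
  ball is Cauchy, and no weak lower semicontinuity is needed.
\<close>

section \<open>Real-variable estimates and an abstract minimization principle\<close>

lemma growth_from_derivative_power_bound:
  fixes f f' :: "real \<Rightarrow> real"
  assumes "\<And>t. (f has_real_derivative f' t) (at t)"
    and "\<And>t. 0 \<le> t \<Longrightarrow> t \<le> 1 \<Longrightarrow> f' t \<le> c * t ^ n"
  shows "f 1 \<le> f 0 + c / (n + 1)"
proof -
  \<comment> \<open>Integrating \<open>c * t ^ n\<close> over the unit interval is replaced by
    monotonicity of antiderivative minus \<open>f\<close>.\<close>
  let ?g = "\<lambda>t. c / (n + 1) * t ^ (n + 1) - f t"
  have "?g 0 \<le> ?g 1"
  proof (rule DERIV_nonneg_imp_nondecreasing[where f = ?g and a = 0 and b = 1])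
    fix t :: real assume t: "0 \<le> t" "t \<le> 1"
    have "(?g has_real_derivative c / (n + 1) * (real (n + 1) * t ^ (n + 1 - Suc 0)) - f' t) (at t)"
      by (rule DERIV_diff[OF DERIV_cmult[OF DERIV_pow] assms(1)])
    moreover have "c / (n + 1) * (real (n + 1) * t ^ (n + 1 - Suc 0)) = c * t ^ n"
      by simp
    ultimately show "\<exists>y. (?g has_real_derivative y) (at t) \<and> 0 \<le> y"
      using assms(2)[OF t] by auto
  qed simp
  then show ?thesis by simp
qed

text \<open>Multiply by \<open>p\<close> and complete the square. With \<open>b\<close> = L|w|^2,
  \<open>p\<close> = 1 - L|w| and \<open>c\<close> = 4|w|^2 + 8/3 L|w|^3 the factor of
  \<open>a\<close> is exactly \<open>C0_hat L w\<close>.\<close>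

lemma le_quadratic_root:
  fixes a b c h p :: real
  assumes "p > 0" "a \<ge> 0" "p * h\<^sup>2 \<le> 2 * b * a * h + c * a\<^sup>2"
  shows "h \<le> 1 / p * (b + sqrt (b\<^sup>2 + p * c)) * a"
proof -
  have "p * (p * h\<^sup>2) \<le> p * (2 * b * a * h + c * a\<^sup>2)"
    using assms(1,3) by (intro mult_left_mono) auto
  then have "(p * h - b * a)\<^sup>2 \<le> (b\<^sup>2 + p * c) * a\<^sup>2"
    by (simp add: power2_eq_square algebra_simps)
  then have "p * h - b * a \<le> sqrt ((b\<^sup>2 + p * c) * a\<^sup>2)"
    by (rule real_le_rsqrt)
  also have "sqrt ((b\<^sup>2 + p * c) * a\<^sup>2) = sqrt (b\<^sup>2 + p * c) * a"
    using assms(2) by (simp add: real_sqrt_mult)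
  finally have "p * h \<le> (b + sqrt (b\<^sup>2 + p * c)) * a"
    unfolding distrib_right by linarith
  then show ?thesis using assms(1) by (simp add: field_simps)
qed

text \<open>Midpoints of a minimizing sequence have values at least the infimum, so the convexity
  gain forces its terms together. Completeness supplies a limit, and norm continuity of
  \<open>f\<close> suffices to pass to it.\<close>

lemma strongly_midpoint_convex_minimizer:
  fixes f :: "'a::{real_inner, complete_space} \<Rightarrow> real"
  assumes S: "closed S" "S \<noteq> {}"
    and mid: "\<And>x y. x \<in> S \<Longrightarrow> y \<in> S \<Longrightarrow> midpoint x y \<in> S"
    and f: "continuous_on S f" "bdd_below (f ` S)"
    and c: "c > 0" "\<And>x y. x \<in> S \<Longrightarrow> y \<in> S \<Longrightarrow>
      2 * f (midpoint x y) + c * (norm (x - y))\<^sup>2 \<le> f x + f y"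
  shows "\<exists>!u. u \<in> S \<and> (\<forall>x\<in>S. f u \<le> f x)"
proof -
  define I where "I = Inf (f ` S)"
  have I: "I \<le> f x" if "x \<in> S" for x
    unfolding I_def using that f(2) by (auto intro: cInf_lower)
  have "\<exists>x\<in>S. f x < I + 1 / real (Suc n)" for n
    using cInf_lessD[of "f ` S" "I + 1 / real (Suc n)"] S(2) by (auto simp: I_def)
  then obtain X where X: "\<And>n. X n \<in> S" "\<And>n. f (X n) < I + 1 / real (Suc n)"
    by metis
  have lim: "(\<lambda>n. 1 / real (Suc n)) \<longlonglongrightarrow> 0"
    using LIMSEQ_inverse_real_of_nat by (simp add: inverse_eq_divide)
  have "Cauchy X"
  proof (rule CauchyI)
    fix e :: real assume e: "e > 0"
    \<comment> \<open>Each of the two values then exceeds the infimum by less than half of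
      \<open>c * e\<^sup>2\<close>.\<close>
    obtain N where N: "\<And>n. n \<ge> N \<Longrightarrow> 1 / real (Suc n) < c * e\<^sup>2 / 2"
      using order_tendstoD(2)[OF lim, of "c * e\<^sup>2 / 2"] c(1) e
      by (auto simp: eventually_sequentially)
    have "norm (X m - X n) < e" if mn: "m \<ge> N" "n \<ge> N" for m n
    proof -
      have "c * (norm (X m - X n))\<^sup>2 \<le> f (X m) + f (X n) - 2 * f (midpoint (X m) (X n))"
        using c(2)[OF X(1) X(1), of m n] by simp
      also have "\<dots> < c * e\<^sup>2"
        using X(2)[of m] X(2)[of n] N[OF mn(1)] N[OF mn(2)] I[OF mid[OF X(1) X(1), of m n]]
        by linarith
      finally have "(norm (X m - X n))\<^sup>2 < e\<^sup>2" using c(1) by simp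
      then show ?thesis using e by (simp add: power_less_imp_less_base)
    qed
    then show "\<exists>M. \<forall>m\<ge>M. \<forall>n\<ge>M. norm (X m - X n) < e" by blast
  qed
  then obtain u where u: "X \<longlonglongrightarrow> u"
    using Cauchy_convergent convergent_def by blast
  have uS: "u \<in> S" using S(1) X(1) u by (rule closed_sequentially)
  have fu: "(\<lambda>n. f (X n)) \<longlonglongrightarrow> f u"
    using continuous_on_tendsto_compose[OF f(1) u uS] X(1) by simp
  have "(\<lambda>n. I + 1 / real (Suc n)) \<longlonglongrightarrow> I + 0"
    by (intro tendsto_intros lim)
  then have "f u \<le> I"
    using LIMSEQ_le[OF fu, of _ I] X(2) by (force intro: less_imp_le)
  then have u_min: "\<forall>x\<in>S. f u \<le> f x" using I by force
  have "v = u" if v: "v \<in> S" "\<forall>x\<in>S. f v \<le> f x" for v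
  proof -
    \<comment> \<open>The midpoint of two minimizers cannot lie below their common value.\<close>
    have "c * (norm (v - u))\<^sup>2 \<le> 0"
      using c(2)[OF v(1) uS] v u_min mid[OF v(1) uS] uS by (smt (verit))
    then show ?thesis using c(1) by (simp add: mult_le_0_iff)
  qed
  then show ?thesis using uS u_min by blast
qed

section \<open>Calculus along line segments\<close>

context
  fixes J :: "'a::real_inner \<Rightarrow> real" and G :: "'a \<Rightarrow> 'a" and K :: "'a \<Rightarrow> 'a \<Rightarrow>\<^sub>L 'a"
  assumes C2: "twice_cont_frechet_differentiable J G K"
begin

lemma functional_line_derivative:
  "((\<lambda>t. J (x + t *\<^sub>R v)) has_real_derivative G (x + t *\<^sub>R v) \<bullet> v) (at t)"
proof -
  have "(J has_derivative (\<lambda>h. h \<bullet> G (x + t *\<^sub>R v))) (at (x + t *\<^sub>R v))"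
    using C2 by (simp add: twice_cont_frechet_differentiable_def gderiv_def)
  moreover have "((\<lambda>t. x + t *\<^sub>R v) has_derivative (\<lambda>h. h *\<^sub>R v)) (at t)"
    by (auto intro!: derivative_eq_intros)
  ultimately have "((\<lambda>t. J (x + t *\<^sub>R v)) has_derivative (\<lambda>h. (h *\<^sub>R v) \<bullet> G (x + t *\<^sub>R v))) (at t)"
    by (rule has_derivative_compose[rotated])
  then show ?thesis
    by (simp add: has_field_derivative_def inner_commute mult_commute_abs)
qed

lemma gradient_line_derivative:
  "((\<lambda>t. G (x + t *\<^sub>R v) \<bullet> z) has_real_derivative K (x + t *\<^sub>R v) v \<bullet> z) (at t)"
proof -
  have "(G has_derivative K (x + t *\<^sub>R v)) (at (x + t *\<^sub>R v))"
    using C2 by (simp add: twice_cont_frechet_differentiable_def)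
  moreover have "((\<lambda>t. x + t *\<^sub>R v) has_derivative (\<lambda>h. h *\<^sub>R v)) (at t)"
    by (auto intro!: derivative_eq_intros)
  ultimately have "((\<lambda>t. G (x + t *\<^sub>R v)) has_derivative (\<lambda>h. K (x + t *\<^sub>R v) (h *\<^sub>R v))) (at t)"
    by (rule has_derivative_compose[rotated])
  from has_derivative_inner_left[OF this, of z] show ?thesis
    by (simp add: has_field_derivative_def blinfun.scaleR_right mult_commute_abs)
qed

lemma functional_continuous: "continuous_on A J"
proof (rule continuous_at_imp_continuous_on, rule ballI)
  show "isCont J x" for x
    using C2 unfolding twice_cont_frechet_differentiable_def gderiv_def
    by (metis has_derivative_continuous)
qed

text \<open>Integrate twice along the segment: the slope drops by at most \<open>c * t\<close>,
  hence the functional by at most \<open>c / 2\<close> below its tangent. The hypothesis concerns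
  the segment alone, so it can be verified inside a ball.\<close>

lemma functional_ge_of_hessian_ge:
  assumes "\<And>t. 0 \<le> t \<Longrightarrow> t \<le> 1 \<Longrightarrow> K (x + t *\<^sub>R v) v \<bullet> v \<ge> - c"
  shows "J (x + v) \<ge> J x + G x \<bullet> v - c / 2"
proof -
  have "G x \<bullet> v - G (x + t *\<^sub>R v) \<bullet> v \<le> c * t ^ 1" if t: "0 \<le> t" "t \<le> 1" for t
  proof -
    \<comment> \<open>Rescaling [0, t] to the unit interval by \<open>s\<close> lets the growth
      lemma be used with exponent 0; its result feeds the second use, with exponent 1.\<close>
    have d: "((\<lambda>s. - (G (x + (s * t) *\<^sub>R v) \<bullet> v)) has_real_derivative
        - (K (x + (s * t) *\<^sub>R v) v \<bullet> v * t)) (at s)" for s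
      by (intro DERIV_minus DERIV_chain2[OF gradient_line_derivative]) (auto intro!: derivative_eq_intros)
    have "- (K (x + (s * t) *\<^sub>R v) v \<bullet> v * t) \<le> c * t * s ^ 0" if s: "0 \<le> s" "s \<le> 1" for s
    proof -
      have "- (K (x + (s * t) *\<^sub>R v) v \<bullet> v) \<le> c"
        using assms[of "s * t"] s t by (simp add: mult_le_one)
      then have "- (K (x + (s * t) *\<^sub>R v) v \<bullet> v) * t \<le> c * t"
        using t by (intro mult_right_mono)
      then show ?thesis by simp
    qed
    from growth_from_derivative_power_bound[OF d this] show ?thesis by simp
  qed
  note bound = this
  have d: "((\<lambda>t. t * (G x \<bullet> v) - J (x + t *\<^sub>R v)) has_real_derivative
      G x \<bullet> v - G (x + t *\<^sub>R v) \<bullet> v) (at t)" for t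
    by (auto intro!: derivative_eq_intros functional_line_derivative)
  from growth_from_derivative_power_bound[OF d bound] show ?thesis by simp
qed

section \<open>Taylor remainders for a Lipschitz Hessian, and symmetry of the Hessian\<close>

context
  fixes L :: real
  assumes Lip: "\<And>x y. norm (K x - K y) \<le> L * norm (x - y)"
begin

lemma hessian_Lipschitz_bound:
  "\<bar>(K y v - K x v) \<bullet> z\<bar> \<le> L * norm (y - x) * norm v * norm z"
proof -
  have "\<bar>(K y v - K x v) \<bullet> z\<bar> \<le> norm ((K y - K x) v) * norm z"
    by (simp add: Cauchy_Schwarz_ineq2 blinfun.diff_left)
  also have "\<dots> \<le> norm (K y - K x) * norm v * norm z"
    by (intro mult_right_mono norm_blinfun) auto
  also have "\<dots> \<le> L * norm (y - x) * norm v * norm z"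
    by (intro mult_right_mono Lip) auto
  finally show ?thesis .
qed

text \<open>Along the segment the remainder has derivative
  \<open>(K (x + t *\<^sub>R v) v - K x v) \<bullet> z\<close>, at most L t |v|^2 |z| in absolute
  value; integrating gives the factor 1/2.\<close>

lemma gradient_Taylor:
  "\<bar>G (x + v) \<bullet> z - G x \<bullet> z - K x v \<bullet> z\<bar> \<le> L / 2 * (norm v)\<^sup>2 * norm z"
proof -
  have d: "((\<lambda>t. s * (G (x + t *\<^sub>R v) \<bullet> z - t * (K x v \<bullet> z))) has_real_derivative
      s * ((K (x + t *\<^sub>R v) v - K x v) \<bullet> z)) (at t)" for s t
    by (auto intro!: derivative_eq_intros gradient_line_derivative simp: inner_diff_left algebra_simps)
  \<comment> \<open>The sign \<open>s\<close> is 1 or -1, so one upper estimate covers both sides of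
    the absolute value.\<close>
  have one: "s * (G (x + v) \<bullet> z - K x v \<bullet> z) \<le> s * (G x \<bullet> z) + L * (norm v)\<^sup>2 * norm z / 2"
    if "\<bar>s\<bar> = 1" for s
  proof -
    have "s * ((K (x + t *\<^sub>R v) v - K x v) \<bullet> z) \<le> L * (norm v)\<^sup>2 * norm z * t ^ 1"
      if t: "0 \<le> t" "t \<le> 1" for t
    proof -
      have "s * ((K (x + t *\<^sub>R v) v - K x v) \<bullet> z) \<le> \<bar>(K (x + t *\<^sub>R v) v - K x v) \<bullet> z\<bar>"
        using \<open>\<bar>s\<bar> = 1\<close> by (metis abs_ge_self abs_mult mult_1)
      also note hessian_Lipschitz_bound[of "x + t *\<^sub>R v" v x z]
      finally show ?thesis using t by (simp add: power2_eq_square mult_ac)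
    qed
    from growth_from_derivative_power_bound[OF d this] show ?thesis by simp
  qed
  show ?thesis using one[of 1, simplified] one[of "- 1", simplified] by linarith
qed

text \<open>The derivative of this remainder is the gradient remainder for the increment
  \<open>t *\<^sub>R v\<close>, bounded by L/2 |v|^3 t^2; integrating gives L/6.\<close>

lemma functional_Taylor:
  "\<bar>J (x + v) - J x - G x \<bullet> v - K x v \<bullet> v / 2\<bar> \<le> L / 6 * norm v ^ 3"
proof -
  have d: "((\<lambda>t. s * (J (x + t *\<^sub>R v) - t * (G x \<bullet> v) - t\<^sup>2 * (K x v \<bullet> v) / 2)) has_real_derivative
      s * (G (x + t *\<^sub>R v) \<bullet> v - G x \<bullet> v - K x (t *\<^sub>R v) \<bullet> v)) (at t)" for s t
    by (auto intro!: derivative_eq_intros functional_line_derivative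
        simp: blinfun.scaleR_right algebra_simps)
  have one: "s * (J (x + v) - G x \<bullet> v - K x v \<bullet> v / 2) \<le> s * J x + L * norm v ^ 3 / 6"
    if "\<bar>s\<bar> = 1" for s
  proof -
    have "s * (G (x + t *\<^sub>R v) \<bullet> v - G x \<bullet> v - K x (t *\<^sub>R v) \<bullet> v) \<le> L / 2 * norm v ^ 3 * t ^ 2"
      if t: "0 \<le> t" "t \<le> 1" for t
    proof -
      have "s * (G (x + t *\<^sub>R v) \<bullet> v - G x \<bullet> v - K x (t *\<^sub>R v) \<bullet> v)
          \<le> \<bar>G (x + t *\<^sub>R v) \<bullet> v - G x \<bullet> v - K x (t *\<^sub>R v) \<bullet> v\<bar>"
        using \<open>\<bar>s\<bar> = 1\<close> by (metis abs_ge_self abs_mult mult_1)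
      also note gradient_Taylor[of x "t *\<^sub>R v" v]
      finally show ?thesis by (simp add: power2_eq_square power3_eq_cube mult_ac)
    qed
    from growth_from_derivative_power_bound[OF d this] show ?thesis by simp
  qed
  show ?thesis using one[of 1, simplified] one[of "- 1", simplified] by linarith
qed

lemma hessian_symmetric: "K x a \<bullet> b = K x b \<bullet> a"
proof -
  \<comment> \<open>The summands are, in order, the t^3 coefficients of the five estimates combined
    below.\<close>
  define M where "M = L / 6 * norm b ^ 3 + L / 2 * (norm a)\<^sup>2 * norm b + L * norm a * (norm b)\<^sup>2 / 2
    + L / 6 * norm (a + b) ^ 3 + L / 6 * norm a ^ 3"
  \<comment> \<open>Expanding J (x + t a + t b) at x + t a and at x gives the same value up to third order.\<close>
  have bound: "\<bar>K x a \<bullet> b - K x b \<bullet> a\<bar> \<le> 2 * M * t" if t: "t > 0" for t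
  proof -
    let ?y = "x + t *\<^sub>R a"
    have scaled: "\<bar>J (x + t *\<^sub>R c) - J x - t * (G x \<bullet> c) - t\<^sup>2 * (K x c \<bullet> c) / 2\<bar> \<le> t ^ 3 * (L / 6 * norm c ^ 3)" for x c
      using functional_Taylor[of x "t *\<^sub>R c"] t
      by (simp add: blinfun.scaleR_right power_mult_distrib power2_eq_square mult_ac)
    have "\<bar>J (?y + t *\<^sub>R b) - J ?y - t * (G ?y \<bullet> b) - t\<^sup>2 * (K ?y b \<bullet> b) / 2\<bar> \<le> t ^ 3 * (L / 6 * norm b ^ 3)"
      by (rule scaled)
    moreover have "\<bar>t * (G ?y \<bullet> b) - t * (G x \<bullet> b) - t\<^sup>2 * (K x a \<bullet> b)\<bar> \<le> t ^ 3 * (L / 2 * (norm a)\<^sup>2 * norm b)"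
      using gradient_Taylor[of x "t *\<^sub>R a" "t *\<^sub>R b"] t
      by (simp add: blinfun.scaleR_right power_mult_distrib power2_eq_square power3_eq_cube mult_ac)
    moreover have "\<bar>t\<^sup>2 * (K ?y b \<bullet> b) / 2 - t\<^sup>2 * (K x b \<bullet> b) / 2\<bar> \<le> t ^ 3 * (L * norm a * (norm b)\<^sup>2 / 2)"
      using hessian_Lipschitz_bound[of ?y "t *\<^sub>R b" x "t *\<^sub>R b"] t
      by (simp add: blinfun.scaleR_right power2_eq_square power3_eq_cube inner_diff_left
          abs_if algebra_simps split: if_splits)
    moreover have "\<bar>J (?y + t *\<^sub>R b) - J x - t * (G x \<bullet> a) - t * (G x \<bullet> b)
        - t\<^sup>2 * (K x a \<bullet> a + K x b \<bullet> a + K x a \<bullet> b + K x b \<bullet> b) / 2\<bar> \<le> t ^ 3 * (L / 6 * norm (a + b) ^ 3)"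
    proof -
      have "?y + t *\<^sub>R b = x + t *\<^sub>R (a + b)" by (simp add: scaleR_add_right)
      then show ?thesis using scaled[of x "a + b"]
        by (simp only: blinfun.add_right inner_add_left inner_add_right distrib_left diff_diff_eq add.assoc)
    qed
    moreover have "\<bar>J ?y - J x - t * (G x \<bullet> a) - t\<^sup>2 * (K x a \<bullet> a) / 2\<bar> \<le> t ^ 3 * (L / 6 * norm a ^ 3)"
      by (rule scaled)
    \<comment> \<open>One expansion has the full mixed term \<open>K x a \<bullet> b\<close>, the
      other the average of both orders. They differ by half the commutator, whence the factor
      2.\<close>
    ultimately have "\<bar>t\<^sup>2 * (K x a \<bullet> b) - t\<^sup>2 * (K x b \<bullet> a)\<bar> \<le> 2 * (t ^ 3 * M)"
      unfolding M_def distrib_left add_divide_distrib by linarith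
    then have "t\<^sup>2 * \<bar>K x a \<bullet> b - K x b \<bullet> a\<bar> \<le> t\<^sup>2 * (2 * M * t)"
      by (simp add: abs_mult right_diff_distrib[symmetric] power2_eq_square power3_eq_cube mult_ac)
    then show ?thesis using t by simp
  qed
  have "((\<lambda>t. 2 * M * t) \<longlongrightarrow> 2 * M * 0) (at_right 0)" by (intro tendsto_intros)
  then have "\<bar>K x a \<bullet> b - K x b \<bullet> a\<bar> \<le> 2 * M * 0"
    by (rule tendsto_lowerbound) (auto simp: eventually_at_filter bound)
  then show ?thesis by simp
qed

section \<open>Estimates around a global minimizer\<close>

context
  fixes xs :: 'a
  assumes min: "global_minimizer J xs"
begin

lemma gradient_minimizer_eq_0: "G xs = 0"
proof -
  \<comment> \<open>Testing along the gradient itself makes the directional derivative its squared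
    norm.\<close>
  have "G (xs + 0 *\<^sub>R G xs) \<bullet> G xs = 0"
    by (rule DERIV_local_min[OF functional_line_derivative, of 1])
       (use min in \<open>auto simp: global_minimizer_def\<close>)
  then show ?thesis by simp
qed

text \<open>With vanishing gradient, the increment of \<open>J\<close> along
  \<open>t *\<^sub>R v\<close> is half the Hessian form times t^2 up to O(t^3). It is nonnegative;
  divide by t^2 and let t tend to 0.\<close>

lemma hessian_minimizer_nonneg: "K xs v \<bullet> v \<ge> 0"
proof -
  define M where "M = L / 6 * norm v ^ 3"
  have bound: "- (K xs v \<bullet> v / 2) \<le> M * t" if t: "t > 0" for t
  proof -
    have "\<bar>J (xs + t *\<^sub>R v) - J xs - t\<^sup>2 * (K xs v \<bullet> v) / 2\<bar> \<le> t ^ 3 * M"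
      using functional_Taylor[of xs "t *\<^sub>R v"] t
      by (simp add: gradient_minimizer_eq_0 M_def blinfun.scaleR_right power_mult_distrib
          power2_eq_square mult_ac)
    moreover have "J xs \<le> J (xs + t *\<^sub>R v)" using min by (simp add: global_minimizer_def)
    ultimately have "t\<^sup>2 * (- (K xs v \<bullet> v / 2)) \<le> t\<^sup>2 * (M * t)"
      by (simp add: power2_eq_square power3_eq_cube mult_ac)
    then show ?thesis using t by (simp only: mult_le_cancel_left_pos zero_less_power)
  qed
  have "((\<lambda>t. M * t) \<longlongrightarrow> M * 0) (at_right 0)" by (intro tendsto_intros)
  then have "- (K xs v \<bullet> v / 2) \<le> M * 0"
    by (rule tendsto_lowerbound) (auto simp: eventually_at_filter bound)
  then show ?thesis by simp
qed

text \<open>Covering the whole sublevel set, not just minimizers, localizes the problem before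
  existence is known.\<close>

lemma tikhonov_sublevel_bound:
  assumes source: "xs - \<xi> = K xs w" and Lw: "L * norm w < 1" and \<alpha>: "\<alpha> > 0"
    and u: "tikhonov J \<xi> \<alpha> u \<le> tikhonov J \<xi> \<alpha> (xs - (2 * \<alpha>) *\<^sub>R w)"
  shows "norm (u - xs) \<le> C0_hat L w * \<alpha>"
proof -
  define h where "h = u - xs"
  let ?A = "K xs" and ?W = "norm w"
  have uh: "u = xs + h" by (simp add: h_def)
  \<comment> \<open>The constant 4/3 is 2^3/6; the same bound at the competitor doubles it to
    8/3.\<close>
  have "\<bar>J (u + (2 * \<alpha>) *\<^sub>R w) - J u - 2 * \<alpha> * (G u \<bullet> w) - 2 * \<alpha>\<^sup>2 * (K u w \<bullet> w)\<bar> \<le> 4 / 3 * L * \<alpha> ^ 3 * ?W ^ 3"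
    using functional_Taylor[of u "(2 * \<alpha>) *\<^sub>R w"] \<alpha>
    by (simp add: blinfun.scaleR_right power_mult_distrib power2_eq_square mult_ac)
  moreover have "J xs \<le> J (u + (2 * \<alpha>) *\<^sub>R w)" using min by (simp add: global_minimizer_def)
  \<comment> \<open>Symmetry turns \<open>?A h \<bullet> w\<close> into
    \<open>?A w \<bullet> h\<close>, the cross term that the source condition produces in the
    penalty.\<close>
  moreover have "2 * \<alpha> * (G u \<bullet> w) \<le> 2 * \<alpha> * (?A w \<bullet> h) + \<alpha> * L * (norm h)\<^sup>2 * ?W"
  proof -
    have "\<bar>G u \<bullet> w - ?A w \<bullet> h\<bar> \<le> L / 2 * (norm h)\<^sup>2 * ?W"
      using gradient_Taylor[of xs h w]
      by (simp add: gradient_minimizer_eq_0 uh hessian_symmetric[of xs h w])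
    then have "G u \<bullet> w \<le> ?A w \<bullet> h + L / 2 * (norm h)\<^sup>2 * ?W" by linarith
    then have "2 * \<alpha> * (G u \<bullet> w) \<le> 2 * \<alpha> * (?A w \<bullet> h + L / 2 * (norm h)\<^sup>2 * ?W)"
      using \<alpha> by (intro mult_left_mono) auto
    then show ?thesis by (simp add: algebra_simps)
  qed
  moreover have "2 * \<alpha>\<^sup>2 * (K u w \<bullet> w) \<le> 2 * \<alpha>\<^sup>2 * (?A w \<bullet> w) + 2 * \<alpha>\<^sup>2 * L * norm h * ?W\<^sup>2"
  proof -
    have "K u w \<bullet> w \<le> ?A w \<bullet> w + L * norm h * ?W\<^sup>2"
      using hessian_Lipschitz_bound[of u w xs w]
      by (simp add: h_def inner_diff_left power2_eq_square mult_ac)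
    then have "2 * \<alpha>\<^sup>2 * (K u w \<bullet> w) \<le> 2 * \<alpha>\<^sup>2 * (?A w \<bullet> w + L * norm h * ?W\<^sup>2)"
      by (intro mult_left_mono) auto
    then show ?thesis by (simp add: algebra_simps)
  qed
  moreover have "\<bar>J (xs - (2 * \<alpha>) *\<^sub>R w) - J xs - 2 * \<alpha>\<^sup>2 * (?A w \<bullet> w)\<bar> \<le> 4 / 3 * L * \<alpha> ^ 3 * ?W ^ 3"
    using functional_Taylor[of xs "- ((2 * \<alpha>) *\<^sub>R w)"] \<alpha>
    by (simp add: gradient_minimizer_eq_0 blinfun.scaleR_right blinfun.minus_right
        power_mult_distrib power2_eq_square mult_ac)
  moreover have "J u + \<alpha> * (norm h)\<^sup>2 + 2 * \<alpha> * (?A w \<bullet> h)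
      \<le> J (xs - (2 * \<alpha>) *\<^sub>R w) + 4 * \<alpha> ^ 3 * ?W\<^sup>2 - 4 * \<alpha>\<^sup>2 * (?A w \<bullet> w)"
  proof -
    have expand: "(norm (xs + k - \<xi>))\<^sup>2 = (norm (?A w))\<^sup>2 + 2 * (?A w \<bullet> k) + (norm k)\<^sup>2" for k
    proof -
      have eq: "xs + k - \<xi> = ?A w + k" using source by (simp add: algebra_simps)
      show ?thesis
        unfolding eq by (simp add: power2_norm_eq_inner inner_add_left inner_add_right inner_commute)
    qed
    have eu: "(norm (u - \<xi>))\<^sup>2 = (norm (?A w))\<^sup>2 + 2 * (?A w \<bullet> h) + (norm h)\<^sup>2"
      unfolding uh by (rule expand)
    have ev: "(norm (xs - (2 * \<alpha>) *\<^sub>R w - \<xi>))\<^sup>2 = (norm (?A w))\<^sup>2 - 4 * \<alpha> * (?A w \<bullet> w) + 4 * \<alpha>\<^sup>2 * ?W\<^sup>2"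
      using expand[of "- ((2 * \<alpha>) *\<^sub>R w)"] by (simp add: power_mult_distrib)
    show ?thesis
      using u unfolding tikhonov_def eu ev
      by (simp add: algebra_simps power2_eq_square[of \<alpha>] power3_eq_cube)
  qed
  \<comment> \<open>On addition the \<open>?A w \<bullet> h\<close> terms cancel, and those in
    \<open>?A w \<bullet> w\<close> have coefficients 2 + 2 - 4 = 0 times \<alpha>^2.\<close>
  ultimately have "\<alpha> * (norm h)\<^sup>2 \<le> \<alpha> * L * (norm h)\<^sup>2 * ?W + 2 * \<alpha>\<^sup>2 * L * norm h * ?W\<^sup>2
      + 4 * \<alpha> ^ 3 * ?W\<^sup>2 + 8 / 3 * L * \<alpha> ^ 3 * ?W ^ 3"
    by linarith
  then have "\<alpha> * ((1 - L * ?W) * (norm h)\<^sup>2)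
      \<le> \<alpha> * (2 * (L * ?W\<^sup>2) * \<alpha> * norm h + (4 * ?W\<^sup>2 + 8 / 3 * L * ?W ^ 3) * \<alpha>\<^sup>2)"
    by (simp add: algebra_simps power2_eq_square power3_eq_cube)
  then have "(1 - L * ?W) * (norm h)\<^sup>2
      \<le> 2 * (L * ?W\<^sup>2) * \<alpha> * norm h + (4 * ?W\<^sup>2 + 8 / 3 * L * ?W ^ 3) * \<alpha>\<^sup>2"
    using \<alpha> by (simp only: mult_le_cancel_left_pos)
  from le_quadratic_root[OF _ _ this] Lw \<alpha> show ?thesis
    by (simp add: C0_hat_def h_def power_mult_distrib flip: power_mult)
qed

text \<open>For half the difference d of the points, \<open>J\<close> loses at most L r |d|^2 of
  midpoint convexity, while the parallelogram law gives the penalty a gain of exactly 2 \<alpha>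
  |d|^2.\<close>

lemma tikhonov_strongly_midpoint_convex:
  assumes L: "L \<ge> 0" and x: "x \<in> cball xs r" and y: "y \<in> cball xs r"
  shows "2 * tikhonov J \<xi> \<alpha> (midpoint x y) + (2 * \<alpha> - L * r) / 4 * (norm (x - y))\<^sup>2
    \<le> tikhonov J \<xi> \<alpha> x + tikhonov J \<xi> \<alpha> y"
proof -
  define m d where "m = midpoint x y" and "d = (1 / 2) *\<^sub>R (x - y)"
  have xm: "x = m + d"
    by (simp add: m_def d_def midpoint_def inverse_eq_divide flip: scaleR_add_right scaleR_2)
  have ym: "y = m + - d"
    using xm by (simp add: m_def d_def midpoint_def inverse_eq_divide scaleR_add_right
        scaleR_diff_right flip: scaleR_add_left)
  \<comment> \<open>These points are convex combinations of \<open>x\<close> and \<open>y\<close>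
    with weights (1 + t)/2 and (1 - t)/2.\<close>
  have ball: "m + t *\<^sub>R d \<in> cball xs r" if "\<bar>t\<bar> \<le> 1" for t
  proof -
    have "((1 + t) / 2) *\<^sub>R x + ((1 - t) / 2) *\<^sub>R y
        = ((1 + t) / 2 + (1 - t) / 2) *\<^sub>R m + ((1 + t) / 2 - (1 - t) / 2) *\<^sub>R d"
      unfolding xm ym
      by (simp only: scaleR_add_right scaleR_add_left scaleR_diff_left scaleR_minus_right) simp
    also have "\<dots> = m + t *\<^sub>R d"
      by (simp add: add_divide_distrib[symmetric] diff_divide_distrib[symmetric])
    finally show ?thesis
      using convexD[OF convex_cball x y, of "(1 + t) / 2" "(1 - t) / 2"] that
      by (simp add: abs_le_iff add_divide_distrib[symmetric])
  qed
  \<comment> \<open>The Hessian is nonnegative at the centre and changes by at most L r in the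
    ball.\<close>
  have hess: "K z v \<bullet> v \<ge> - (L * r * (norm v)\<^sup>2)" if "z \<in> cball xs r" for z v
  proof -
    have "\<bar>(K z v - K xs v) \<bullet> v\<bar> \<le> L * norm (z - xs) * norm v * norm v"
      by (rule hessian_Lipschitz_bound)
    also have "\<dots> \<le> L * r * norm v * norm v"
      using that L by (intro mult_right_mono mult_left_mono) (auto simp: dist_norm norm_minus_commute)
    finally show ?thesis
      using hessian_minimizer_nonneg[of v] by (simp add: inner_diff_left power2_eq_square mult_ac)
  qed
  have "J x \<ge> J m + G m \<bullet> d - L * r * (norm d)\<^sup>2 / 2"
    unfolding xm by (intro functional_ge_of_hessian_ge hess ball) auto
  moreover have "J y \<ge> J m + G m \<bullet> (- d) - L * r * (norm (- d))\<^sup>2 / 2"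
    unfolding ym
    by (intro functional_ge_of_hessian_ge hess) (use ball[of "- t" for t] in auto)
  ultimately have "2 * J m - L * r * (norm d)\<^sup>2 \<le> J x + J y" by simp
  moreover have "(norm (x - \<xi>))\<^sup>2 + (norm (y - \<xi>))\<^sup>2 = 2 * (norm (m - \<xi>))\<^sup>2 + 2 * (norm d)\<^sup>2"
    unfolding xm ym
    by (simp add: power2_norm_eq_inner inner_add_left inner_add_right inner_diff_left
        inner_diff_right inner_commute)
  then have "\<alpha> * (norm (x - \<xi>))\<^sup>2 + \<alpha> * (norm (y - \<xi>))\<^sup>2 = 2 * \<alpha> * (norm (m - \<xi>))\<^sup>2 + 2 * \<alpha> * (norm d)\<^sup>2"
    by algebra
  moreover have "(norm d)\<^sup>2 = (norm (x - y))\<^sup>2 / 4" by (simp add: d_def power_divide)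
  ultimately show ?thesis
    by (simp add: tikhonov_def m_def[symmetric] algebra_simps diff_divide_distrib)
qed

end

end

end

section \<open>Existence, uniqueness and the convergence rate\<close>

theorem theorem3p1:
  fixes J :: "'a::{real_inner, complete_space} \<Rightarrow> real"
    and G :: "'a \<Rightarrow> 'a"
    and K :: "'a \<Rightarrow> 'a \<Rightarrow>\<^sub>L 'a"
    and xstar \<xi> w :: 'a
    and L :: real
  assumes "twice_cont_frechet_differentiable J G K"
    and "global_minimizer J xstar"
    and "L > 0"
    and "\<And>x y. norm (K x - K y) \<le> L * norm (x - y)"
    and "xstar - \<xi> = blinfun_apply (K xstar) w"
    and "L * norm w < 1"
    and "L * C0_hat L w < 2"
  shows "\<forall>\<alpha>>0. (\<exists>!u. global_minimizer (tikhonov J \<xi> \<alpha>) u) \<and>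
           (\<forall>u. global_minimizer (tikhonov J \<xi> \<alpha>) u \<longrightarrow> norm (u - xstar) \<le> C0_hat L w * \<alpha>)"
proof (intro allI impI)
  fix \<alpha> :: real assume \<alpha>: "\<alpha> > 0"
  let ?T = "tikhonov J \<xi> \<alpha>" and ?B = "cball xstar (C0_hat L w * \<alpha>)"
  let ?v = "xstar - (2 * \<alpha>) *\<^sub>R w"
  have sub: "norm (u - xstar) \<le> C0_hat L w * \<alpha>" if "?T u \<le> ?T ?v" for u
    using tikhonov_sublevel_bound[OF assms(1,4,2,5,6) \<alpha> that] .
  have subB: "u \<in> ?B" if "?T u \<le> ?T ?v" for u
    using sub[OF that] by (simp add: dist_norm norm_minus_commute)
  have "\<exists>!u. u \<in> ?B \<and> (\<forall>x\<in>?B. ?T u \<le> ?T x)"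
  proof (rule strongly_midpoint_convex_minimizer)
    \<comment> \<open>The competitor belongs to its own sublevel set, hence to the ball.\<close>
    show "?B \<noteq> {}" using subB[of ?v] by blast
    show "midpoint x y \<in> ?B" if "x \<in> ?B" "y \<in> ?B" for x y
      using convexD[OF convex_cball that, of "1 / 2" "1 / 2"]
      by (simp add: midpoint_def scaleR_add_right inverse_eq_divide)
    show "continuous_on ?B ?T"
      unfolding tikhonov_def[abs_def]
      by (intro continuous_intros functional_continuous[OF assms(1)])
    show "bdd_below (?T ` ?B)"
    proof (rule bdd_belowI2)
      show "J xstar \<le> ?T x" for x
        using assms(2) \<alpha> by (auto simp: global_minimizer_def tikhonov_def intro: add_increasing2)
    qed
    show "0 < (2 * \<alpha> - L * (C0_hat L w * \<alpha>)) / 4"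
      using mult_strict_right_mono[OF assms(7) \<alpha>] by (simp add: mult.assoc)
    show "2 * ?T (midpoint x y) + (2 * \<alpha> - L * (C0_hat L w * \<alpha>)) / 4 * (norm (x - y))\<^sup>2 \<le> ?T x + ?T y"
      if "x \<in> ?B" "y \<in> ?B" for x y
      using tikhonov_strongly_midpoint_convex[OF assms(1,4,2) _ that] assms(3) by simp
  qed simp
  \<comment> \<open>Outside the ball \<open>?T\<close> exceeds its value at \<open>?v\<close>, which
    lies inside, so minimizing over the ball and over the whole space are equivalent.\<close>
  moreover have "global_minimizer ?T u \<longleftrightarrow> u \<in> ?B \<and> (\<forall>x\<in>?B. ?T u \<le> ?T x)" for u
    unfolding global_minimizer_def using subB by (meson linear order_trans order_refl)
  ultimately have "\<exists>!u. global_minimizer ?T u" by simp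
  then show "(\<exists>!u. global_minimizer ?T u) \<and>
      (\<forall>u. global_minimizer ?T u \<longrightarrow> norm (u - xstar) \<le> C0_hat L w * \<alpha>)"
    using sub by (auto simp: global_minimizer_def)
qed

end
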